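(* Let $f\colon \mathbb{R}^n\to[-\infty,+\infty]$ be a convex function of Legendre type, let $U=\operatorname{int}\operatorname{dom} f$, and let $C$ be a nonempty closed subset of $\mathbb{R}^n$ with $C\subseteq U$. Suppose that $C$ is bounded and that $C$ is a left Klee set with respect to the Bregman distance $D_f$, i.e., for every $y\in U$ the set of left Bregman farthest points $\overleftarrow{Q}_{C}(y)$ is a singleton. Then $C$ is a singleton.
   Context: $\mathbb{R}^n$ carries the standard inner product $\langle\cdot,\cdot\rangle$. A convex function of Legendre type (Legendre function) is a proper lower semicontinuous convex function $f$ such that $U=\operatorname{int}\operatorname{dom} f\neq\varnothing$, $f$ is differentiable on $U$ with $\|\nabla f(x_k)\|\to+\infty$ whenever $(x_k)$ is a sequence in $U$ converging to a boundary point of $U$, and $f$ is strictly convex on $U$. The Bregman distance of $f$ is $D_f(x,y)=D(x,y)=f(x)-f(y)-\langle\nabla f(y),x-y\rangle$ if $y\in U$, and $D(x,y)=+\infty$ otherwise. The left Bregman farthest-distance function of $C$ is $\overleftarrow{F}_{C}(y)=\sup_{x\in C}D(x,y)$, and the left Bregman farthest-points map is $\overleftarrow{Q}_{C}(y)=\{x\in C : D(x,y)=\overleftarrow{F}_{C}(y)<+\infty\}$. *)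

theory Defs
  imports "HOL-Analysis.Analysis"
begin

section \<open>Extended-real-valued convex functions\<close>

definition edom :: "('a \<Rightarrow> ereal) \<Rightarrow> 'a set" where
  "edom f = {x. f x < \<infinity>}"

definition proper_fun :: "('a \<Rightarrow> ereal) \<Rightarrow> bool" where
  "proper_fun f \<longleftrightarrow> edom f \<noteq> {} \<and> (\<forall>x. f x \<noteq> - \<infinity>)"

definition lsc_fun :: "('a::topological_space \<Rightarrow> ereal) \<Rightarrow> bool" where
  "lsc_fun f \<longleftrightarrow> (\<forall>x. f x \<le> Liminf (at x) f)"

text \<open>Convexity is convexity of the epigraph, which avoids the sum of \<open>\<infinity>\<close> and \<open>- \<infinity>\<close>.
  The library's \<open>epigraph\<close> and \<open>convex_on\<close> apply to real-valued functions only.\<close>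

definition convex_fun :: "('a::real_vector \<Rightarrow> ereal) \<Rightarrow> bool" where
  "convex_fun f \<longleftrightarrow> convex {(x, r::real). f x \<le> ereal r}"

definition strictly_convex_fun_on :: "'a::real_vector set \<Rightarrow> ('a \<Rightarrow> ereal) \<Rightarrow> bool" where
  "strictly_convex_fun_on S f \<longleftrightarrow> convex S \<and>
    (\<forall>x\<in>S. \<forall>y\<in>S. \<forall>t::real. x \<noteq> y \<and> 0 < t \<and> t < 1 \<longrightarrow>
      f ((1 - t) *\<^sub>R x + t *\<^sub>R y) < ereal (1 - t) * f x + ereal t * f y)"

text \<open>The next two notions are used only at interior points of the domain of a proper function.
  Such a function is finite near these points, so \<open>real_of_ereal\<close> is harmless there.\<close>

definition ediff_at :: "('a::real_inner \<Rightarrow> ereal) \<Rightarrow> 'a \<Rightarrow> bool" where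
  "ediff_at f x \<longleftrightarrow> (\<lambda>z. real_of_ereal (f z)) differentiable (at x)"

definition egrad :: "('a::real_inner \<Rightarrow> ereal) \<Rightarrow> 'a \<Rightarrow> 'a" where
  "egrad f x = (THE g. GDERIV (\<lambda>z. real_of_ereal (f z)) x :> g)"

definition legendre :: "('a::euclidean_space \<Rightarrow> ereal) \<Rightarrow> bool" where
  "legendre f \<longleftrightarrow>
     proper_fun f \<and> lsc_fun f \<and> convex_fun f \<and>
     interior (edom f) \<noteq> {} \<and>
     (\<forall>x\<in>interior (edom f). ediff_at f x) \<and>
     (\<forall>X x. (\<forall>k. X k \<in> interior (edom f)) \<and> X \<longlonglongrightarrow> x \<and> x \<in> frontier (interior (edom f))
        \<longrightarrow> filterlim (\<lambda>k. norm (egrad f (X k))) at_top sequentially) \<and>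
     strictly_convex_fun_on (interior (edom f)) f"

section \<open>Bregman distances and left Klee sets\<close>

definition bregman :: "('a::euclidean_space \<Rightarrow> ereal) \<Rightarrow> 'a \<Rightarrow> 'a \<Rightarrow> ereal" where
  "bregman f x y =
     (if y \<in> interior (edom f) then f x - f y - ereal (egrad f y \<bullet> (x - y)) else \<infinity>)"

definition left_farthest_dist :: "('a::euclidean_space \<Rightarrow> ereal) \<Rightarrow> 'a set \<Rightarrow> 'a \<Rightarrow> ereal" where
  "left_farthest_dist f C y = (SUP x\<in>C. bregman f x y)"

definition left_farthest_points :: "('a::euclidean_space \<Rightarrow> ereal) \<Rightarrow> 'a set \<Rightarrow> 'a \<Rightarrow> 'a set" where
  "left_farthest_points f C y =
     {x \<in> C. bregman f x y = left_farthest_dist f C y \<and> left_farthest_dist f C y < \<infinity>}"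

definition left_klee :: "('a::euclidean_space \<Rightarrow> ereal) \<Rightarrow> 'a set \<Rightarrow> bool" where
  "left_klee f C \<longleftrightarrow> (\<forall>y\<in>interior (edom f). is_singleton (left_farthest_points f C y))"

end

theory Submission
  imports Defs
begin

text \<open>On the compact convex set \<open>K = convex hull C\<close>, which lies in \<open>U\<close>, the farthest-point
  selection \<open>Q\<close> has a closed graph because \<open>\<nabla>f\<close> is continuous on \<open>U\<close>; hence
  \<open>Q : K \<rightarrow> C \<subseteq> K\<close> is continuous and, by Brouwer, has a fixed point \<open>y\<close>.
  All of \<open>C\<close> is at Bregman distance at most \<open>D(y, y) = 0\<close> from \<open>y\<close>, so strict convexity
  forces \<open>C = {y}\<close>.\<close>

text \<open>On the segment from \<open>y\<close> to \<open>x\<close>, convexity bounds each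
  difference quotient at \<open>y\<close> with step in (0, 1) by \<open>\<phi> x - \<phi> y\<close>.
  As the step tends to 0 from the right, the quotients tend to
  \<open>g \<bullet> (x - y)\<close>.\<close>

lemma convex_on_gradient_inequality:
  fixes \<phi> :: "'a::real_inner \<Rightarrow> real"
  assumes "convex_on U \<phi>" and "x \<in> U" and "y \<in> U" and "GDERIV \<phi> y :> g"
  shows "\<phi> y + g \<bullet> (x - y) \<le> \<phi> x"
proof -
  let ?p = "\<lambda>t::real. \<phi> (y + t *\<^sub>R (x - y))"
  have "(\<phi> has_derivative (\<lambda>h. g \<bullet> h)) (at (y + 0 *\<^sub>R (x - y)))"
    using assms(4) by (simp add: gderiv_def inner_commute)
  moreover have "((\<lambda>t::real. y + t *\<^sub>R (x - y)) has_derivative (\<lambda>t. t *\<^sub>R (x - y))) (at 0)"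
    by (auto intro!: derivative_eq_intros)
  ultimately have "(?p has_derivative (\<lambda>t. g \<bullet> (t *\<^sub>R (x - y)))) (at 0)"
    using has_derivative_compose by blast
  then have "(?p has_field_derivative (g \<bullet> (x - y))) (at 0)"
    by (simp add: has_field_derivative_def mult.commute[of "g \<bullet> (x - y)"] fun_eq_iff
        inner_scaleR_right mult_commute_abs)
  then have "((\<lambda>t. (?p t - \<phi> y) / t) \<longlongrightarrow> g \<bullet> (x - y)) (at_right 0)"
    using has_field_derivative_at_within[of ?p "g \<bullet> (x - y)" 0 "{0<..}"]
    by (simp add: has_field_derivative_iff)
  moreover have "\<forall>\<^sub>F t in at_right 0. (?p t - \<phi> y) / t \<le> \<phi> x - \<phi> y"
  proof (rule eventually_at_rightI)
    fix t :: real assume t: "t \<in> {0<..<1}"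
    have "\<phi> ((1 - t) *\<^sub>R y + t *\<^sub>R x) \<le> (1 - t) * \<phi> y + t * \<phi> x"
      using assms t by (intro convex_onD) auto
    moreover have "(1 - t) *\<^sub>R y + t *\<^sub>R x = y + t *\<^sub>R (x - y)"
      by (simp add: algebra_simps)
    ultimately show "(?p t - \<phi> y) / t \<le> \<phi> x - \<phi> y"
      using t by (simp add: field_simps)
  qed simp
  ultimately have "g \<bullet> (x - y) \<le> \<phi> x - \<phi> y"
    by (intro tendsto_upperbound) auto
  then show ?thesis by simp
qed

text \<open>If \<open>g y'\<close> differs from \<open>g y\<close> by norm \<open>n\<close>, move
  from \<open>y\<close> a distance \<open>d\<close> in the direction \<open>g y' - g y\<close>. The
  gradient inequality at \<open>y'\<close> makes \<open>\<phi>\<close> exceed its linearization at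
  \<open>y\<close> by an amount proportional to \<open>d * n\<close>, up to small errors, while
  differentiability at \<open>y\<close> permits only \<open>c * d\<close>. So \<open>n\<close> is at
  most a multiple of \<open>c\<close>.\<close>

lemma convex_on_continuous_on_gradient:
  fixes \<phi> :: "'a::real_inner \<Rightarrow> real"
  assumes "open U" and "convex_on U \<phi>" and G: "\<And>y. y \<in> U \<Longrightarrow> GDERIV \<phi> y :> g y"
  shows "continuous_on U g"
  unfolding continuous_on_iff
proof (intro ballI allI impI)
  fix y and e :: real
  assume y: "y \<in> U" and "0 < e"
  \<comment> \<open>The estimates below end in \<open>n \<le> 4 * c\<close>, which is
    \<open>e / 2\<close>.\<close>
  define c where "c = e / 8"
  have "0 < c" using \<open>0 < e\<close> by (simp add: c_def)
  obtain r where r: "0 < r" "\<And>z. norm (z - y) < r \<Longrightarrow>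
      norm (\<phi> z - \<phi> y - (z - y) \<bullet> g y) \<le> c * norm (z - y)"
    using G[OF y] \<open>0 < c\<close> unfolding gderiv_def has_derivative_at_alt by metis
  obtain s where s: "0 < s" "ball y s \<subseteq> U"
    using \<open>open U\<close> y openE by blast
  \<comment> \<open>A step of length exactly \<open>d\<close> must stay strictly inside both balls:
    the one where the expansion at \<open>y\<close> holds and the one contained in
    \<open>U\<close>.\<close>
  define d where "d = min r s / 2"
  have d: "0 < d" "d < r" "d < s" using r s by (auto simp: d_def)
  show "\<exists>\<delta>>0. \<forall>y'\<in>U. dist y' y < \<delta> \<longrightarrow> dist (g y') (g y) < e"
  \<comment> \<open>With \<open>y'\<close> within \<open>d / 2\<close> of \<open>y\<close>, the
    Cauchy-Schwarz term below costs at most half of the gain \<open>d * n\<close> and can be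
    absorbed.\<close>
  proof (intro exI[of _ "d / 2"] conjI ballI impI)
    show "0 < d / 2" using d by simp
    fix y' assume y': "y' \<in> U" "dist y' y < d / 2"
    show "dist (g y') (g y) < e"
    proof (cases "g y' = g y")
      case False
      define n where "n = norm (g y' - g y)"
      have n: "0 < n" using False by (simp add: n_def)
      define h where "h = (d / n) *\<^sub>R (g y' - g y)"
      have nh: "norm h = d" using n d by (simp add: h_def n_def)
      have gh: "g y' \<bullet> h - g y \<bullet> h = d * n"
      proof -
        have "(g y' - g y) \<bullet> (g y' - g y) = n * n"
          by (simp add: n_def power2_norm_eq_inner[symmetric] power2_eq_square)
        then have "(g y' - g y) \<bullet> h = d * n"
          using n by (simp add: h_def)
        then show ?thesis by (simp add: inner_diff_left)
      qed
      have dy: "norm (y' - y) < d / 2" using y' by (simp add: dist_norm)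
      have "y + h \<in> U" using s nh d by (auto simp: dist_norm)
      then have 1: "\<phi> y' + g y' \<bullet> (y + h - y') \<le> \<phi> (y + h)"
        using convex_on_gradient_inequality[OF assms(2) _ y'(1) G[OF y'(1)]] by blast
      have 2: "\<phi> (y + h) - \<phi> y - g y \<bullet> h \<le> c * d"
        using r(2)[of "y + h"] nh d by (simp add: inner_commute abs_le_iff)
      have "\<bar>\<phi> y' - \<phi> y - (y' - y) \<bullet> g y\<bar> \<le> c * norm (y' - y)"
        using r(2)[of y'] dy d by simp
      moreover have "c * norm (y' - y) \<le> c * d"
        using dy d \<open>0 < c\<close> by (intro mult_left_mono) auto
      ultimately have 3: "\<phi> y - \<phi> y' + g y \<bullet> (y' - y) \<le> c * d"
        by (simp add: inner_commute abs_le_iff)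
      have "(g y' - g y) \<bullet> (y' - y) \<le> n * norm (y' - y)"
        unfolding n_def by (rule norm_cauchy_schwarz)
      also have "\<dots> \<le> n * (d / 2)"
        using dy n by (intro mult_left_mono) auto
      finally have 4: "(g y' - g y) \<bullet> (y' - y) \<le> n * (d / 2)" .
      have "d * n \<le> 2 * (c * d) + n * (d / 2)"
        using 1 2 3 4 gh by (simp add: inner_diff_left inner_diff_right inner_add_right)
      then have "d * n \<le> d * (4 * c)" by (simp add: algebra_simps)
      then have "n \<le> 4 * c" using d by simp
      then show ?thesis using \<open>0 < e\<close> by (simp add: c_def n_def dist_norm)
    qed (use \<open>0 < e\<close> in simp)
  qed
qed

text \<open>This justifies the definite description in \<open>egrad\<close>: the derivative is a
  linear functional, represented by the vector \<open>adjoint D 1\<close>, and uniqueness of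
  derivatives makes this vector unique.\<close>

lemma GDERIV_egrad:
  fixes f :: "'a::euclidean_space \<Rightarrow> ereal"
  assumes "ediff_at f x"
  shows "GDERIV (\<lambda>z. real_of_ereal (f z)) x :> egrad f x"
proof -
  obtain D where D: "((\<lambda>z. real_of_ereal (f z)) has_derivative D) (at x)"
    using assms unfolding ediff_at_def differentiable_def by blast
  have "D h = h \<bullet> adjoint D 1" for h
    using adjoint_works[OF has_derivative_linear[OF D], of h 1] by simp
  then have "D = (\<lambda>h. h \<bullet> adjoint D 1)" by blast
  then have ex: "GDERIV (\<lambda>z. real_of_ereal (f z)) x :> adjoint D 1"
    unfolding gderiv_def using D by simp
  show ?thesis
    unfolding egrad_def
  proof (rule theI[where P = "\<lambda>g. GDERIV (\<lambda>z. real_of_ereal (f z)) x :> g", OF ex])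
    fix g' assume "GDERIV (\<lambda>z. real_of_ereal (f z)) x :> g'"
    then have "(\<lambda>h. h \<bullet> g') = (\<lambda>h. h \<bullet> adjoint D 1)"
      using ex unfolding gderiv_def by (rule has_derivative_unique)
    then have "\<forall>h. h \<bullet> g' = h \<bullet> adjoint D 1" by meson
    then show "g' = adjoint D 1" by (simp add: vector_eq_ldot)
  qed
qed

text \<open>For fixed \<open>y\<close>, the distance \<open>bregman f z y\<close> differs from
  \<open>\<phi> z - egrad f y \<bullet> z\<close> by a constant independent of \<open>z\<close>.
  Being farthest thus becomes a family of non-strict real inequalities, suited to a closed-graph
  argument.\<close>

lemma left_farthest_points_iff:
  assumes finite: "\<And>x. x \<in> interior (edom f) \<Longrightarrow> f x = ereal (\<phi> x)"
    and C: "C \<subseteq> interior (edom f)" and y: "y \<in> interior (edom f)"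
  shows "x \<in> left_farthest_points f C y \<longleftrightarrow>
    x \<in> C \<and> (\<forall>z\<in>C. \<phi> z - egrad f y \<bullet> z \<le> \<phi> x - egrad f y \<bullet> x)"
proof -
  let ?d = "\<lambda>z. \<phi> z - \<phi> y - egrad f y \<bullet> (z - y)"
  have D: "bregman f z y = ereal (?d z)" if "z \<in> C" for z
    using finite[of z] finite[OF y] that C y by (auto simp: bregman_def)
  have "bregman f x y = left_farthest_dist f C y \<longleftrightarrow> (\<forall>z\<in>C. ?d z \<le> ?d x)" if x: "x \<in> C"
  proof
    assume "bregman f x y = left_farthest_dist f C y"
    then have "\<forall>z\<in>C. bregman f z y \<le> bregman f x y"
      by (auto simp: left_farthest_dist_def intro: SUP_upper)
    then show "\<forall>z\<in>C. ?d z \<le> ?d x" using D x by auto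
  next
    assume "\<forall>z\<in>C. ?d z \<le> ?d x"
    then have "(SUP z\<in>C. bregman f z y) = bregman f x y"
      using D x by (intro SUP_eqI) auto
    then show "bregman f x y = left_farthest_dist f C y"
      by (simp add: left_farthest_dist_def)
  qed
  moreover have "bregman f x y < \<infinity>" if "x \<in> C" using D that by simp
  moreover have "?d z \<le> ?d x \<longleftrightarrow> \<phi> z - egrad f y \<bullet> z \<le> \<phi> x - egrad f y \<bullet> x" for z
    by (simp add: inner_diff_right)
  ultimately show ?thesis
    unfolding left_farthest_points_def by auto
qed

theorem theorem4p3:
  fixes f :: "real ^ 'n \<Rightarrow> ereal" and C :: "(real ^ 'n) set"
  assumes "legendre f"
    and "C \<noteq> {}" and "closed C" and "C \<subseteq> interior (edom f)"
    and "bounded C"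
    and "left_klee f C"
  shows "is_singleton C"
proof -
  define U where "U = interior (edom f)"
  define \<phi> where "\<phi> = (\<lambda>z. real_of_ereal (f z))"
  define g where "g = egrad f"
  define K where "K = convex hull C"
  have finite: "f x = ereal (\<phi> x)" if "x \<in> U" for x
  proof -
    have "f x < \<infinity>" using that interior_subset unfolding U_def edom_def by blast
    moreover have "f x \<noteq> - \<infinity>" using assms(1) by (simp add: legendre_def proper_fun_def)
    ultimately show ?thesis by (cases "f x") (auto simp: \<phi>_def)
  qed
  have "convex U"
    using assms(1) by (simp add: legendre_def strictly_convex_fun_on_def U_def)
  have strict: "\<phi> ((1 - t) *\<^sub>R x + t *\<^sub>R y) < (1 - t) * \<phi> x + t * \<phi> y"
    if "x \<in> U" "y \<in> U" "x \<noteq> y" "0 < t" "t < 1" for x y t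
  proof -
    have "(1 - t) *\<^sub>R x + t *\<^sub>R y \<in> U"
      using \<open>convex U\<close> that by (intro convexD) auto
    moreover have "f ((1 - t) *\<^sub>R x + t *\<^sub>R y) < ereal (1 - t) * f x + ereal t * f y"
      using assms(1) that by (simp add: legendre_def strictly_convex_fun_on_def U_def)
    ultimately show ?thesis using that by (simp add: finite)
  qed
  have conv: "convex_on U \<phi>"
  proof (rule convex_onI[OF _ \<open>convex U\<close>])
    fix t :: real and x y assume "0 < t" "t < 1" "x \<in> U" "y \<in> U"
    then show "\<phi> ((1 - t) *\<^sub>R x + t *\<^sub>R y) \<le> (1 - t) * \<phi> x + t * \<phi> y"
      using strict[of x y t] by (cases "x = y") (auto simp: algebra_simps)
  qed
  have G: "GDERIV \<phi> y :> g y" if "y \<in> U" for y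
    using GDERIV_egrad[of f y] assms(1) that by (simp add: legendre_def U_def \<phi>_def g_def)
  have "open U" by (simp add: U_def)
  have contg: "continuous_on U g"
    using convex_on_continuous_on_gradient[OF \<open>open U\<close> conv] G by blast
  have cont\<phi>: "continuous_on U \<phi>"
    using G by (meson GDERIV_DERIV_compose gderiv_def continuous_at_imp_continuous_on
        has_derivative_continuous)
  have CU: "C \<subseteq> U" using assms(4) by (simp add: U_def)
  have "compact C" using assms(3,5) by (simp add: compact_eq_bounded_closed)
  have K: "compact K" "convex K" "K \<noteq> {}" "K \<subseteq> U" "C \<subseteq> K"
    using \<open>compact C\<close> assms(2) CU \<open>convex U\<close>
    by (auto simp: K_def compact_convex_hull hull_subset subset_hull hull_inc)
  have "\<exists>q. left_farthest_points f C y = {q}" if "y \<in> U" for y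
    using assms(6) that by (simp add: left_klee_def U_def is_singleton_def)
  then obtain Q where "\<And>y. y \<in> U \<Longrightarrow> left_farthest_points f C y = {Q y}"
    by metis
  \<comment> \<open>The Klee property makes this an equivalence: every maximizer over
    \<open>C\<close> equals \<open>Q y\<close>.\<close>
  then have Q: "x = Q y \<longleftrightarrow> x \<in> C \<and> (\<forall>z\<in>C. \<phi> z - g y \<bullet> z \<le> \<phi> x - g y \<bullet> x)"
    if "y \<in> U" for x y
    using left_farthest_points_iff[of f \<phi> C y x] finite CU that
    unfolding U_def g_def by auto
  have QC: "Q y \<in> C" if "y \<in> U" for y using Q that by blast
  have Qmax: "\<phi> z - g y \<bullet> z \<le> \<phi> (Q y) - g y \<bullet> Q y" if "y \<in> U" "z \<in> C" for y z
    using Q[OF that(1), of "Q y"] that(2) by simp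
  \<comment> \<open>The graph of \<open>Q\<close> is cut out by one inequality for each
    \<open>z\<close> in \<open>C\<close>; a pair satisfying all of them lies on the graph because
    the maximizer is unique.\<close>
  have "(\<lambda>y. (y, Q y)) ` K =
      (K \<times> C) \<inter> (\<Inter>z\<in>C. {p \<in> K \<times> C. \<phi> z - g (fst p) \<bullet> z \<le> \<phi> (snd p) - g (fst p) \<bullet> snd p})"
    using Q QC Qmax K(4) by (auto simp: image_iff subset_iff)
  moreover have KC: "closed (K \<times> C)"
    using compact_imp_closed[OF K(1)] assms(3) by (rule closed_Times)
  moreover have "closed {p \<in> K \<times> C. \<phi> z - g (fst p) \<bullet> z \<le> \<phi> (snd p) - g (fst p) \<bullet> snd p}" for z
  proof (rule continuous_on_closed_Collect_le)
    show "closed (K \<times> C)" by (fact KC)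
    have "continuous_on (K \<times> C) (\<lambda>p. g (fst p))" "continuous_on (K \<times> C) (\<lambda>p. \<phi> (snd p))"
      using K CU by (auto intro!: continuous_on_compose2[OF contg] continuous_on_compose2[OF cont\<phi>]
          continuous_intros)
    then show "continuous_on (K \<times> C) (\<lambda>p. \<phi> z - g (fst p) \<bullet> z)"
      "continuous_on (K \<times> C) (\<lambda>p. \<phi> (snd p) - g (fst p) \<bullet> snd p)"
      by (auto intro!: continuous_intros)
  qed
  ultimately have "closed ((\<lambda>y. (y, Q y)) ` K)"
    by (metis (no_types, lifting) closed_Int closed_INT)
  \<comment> \<open>A map into the compact set \<open>C\<close> with closed graph is
    continuous.\<close>
  then have "continuous_on K Q"
    using QC K(4) \<open>compact C\<close> by (intro continuous_from_closed_graph[of C]) auto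
  then obtain y where y: "y \<in> K" "Q y = y"
    using brouwer[OF K(1-3), of Q] QC K(4,5) by blast
  then have yU: "y \<in> U" and yC: "y \<in> C" using K(4) QC by force+
  have "x = y" if "x \<in> C" for x
  proof (rule ccontr)
    assume "x \<noteq> y"
    have xU: "x \<in> U" using that CU by blast
    \<comment> \<open>As \<open>y\<close> is its own farthest point, this says that the Bregman
      distance from \<open>x\<close> to \<open>y\<close> is at most 0.\<close>
    have le: "\<phi> x - g y \<bullet> x \<le> \<phi> y - g y \<bullet> y" using Qmax[OF yU that] y by simp
    \<comment> \<open>At the midpoint, the gradient inequality at \<open>y\<close> bounds
      \<open>\<phi>\<close> from below and strict convexity bounds it strictly from above. Together
      they give \<open>g y \<bullet> (x - y) < \<phi> x - \<phi> y\<close>, contrary to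
      \<open>le\<close>.\<close>
    let ?m = "(1 - 1 / 2) *\<^sub>R x + (1 / 2) *\<^sub>R y"
    have "?m \<in> U" using \<open>convex U\<close> xU yU by (intro convexD) auto
    then have "\<phi> y + g y \<bullet> (?m - y) \<le> \<phi> ?m"
      using convex_on_gradient_inequality[OF conv _ yU G[OF yU]] by blast
    moreover have "\<phi> ?m < (1 - 1 / 2) * \<phi> x + (1 / 2) * \<phi> y"
      using strict[OF xU yU \<open>x \<noteq> y\<close>, of "1 / 2"] by simp
    ultimately show False
      using le by (simp add: inner_diff_right inner_add_right)
  qed
  then have "C = {y}" using yC by blast
  then show ?thesis by simp
qed

end
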